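(* Let $k\ge 1$ be any fixed integer constant and let $\alpha$ be any real constant. Any non-adaptive randomized algorithm that, with probability at least $2/3$, $\alpha$-estimates the number of defective items in a set of $n$ items (that is, for every set of defective items $I$, returns with probability at least $2/3$ an estimate of $|I|$ to within the constant factor $\alpha$) must make at least $$\Omega\left(\frac{\log n}{\log^{[k]} n}\right)$$ tests. Here $\Omega(\cdot)$ is as $n\to\infty$: there exist $c>0$ and $n_0$, depending only on $\alpha$ and $k$, such that for all $n\ge n_0$ any such algorithm makes at least $c\,\log n/\log^{[k]}n$ tests on $n$ items.
   Context: Group testing. The set of items is $X=[n]=\{1,\dots,n\}$ and an unknown set $I\subseteq X$ is the set of defective items. A test is a subset $Q\subseteq X$; its answer is $\mathcal{O}_I(Q)=1$ if $Q\cap I\neq\emptyset$ and $\mathcal{O}_I(Q)=0$ otherwise. The algorithm knows $n$ and accesses $I$ only through the test oracle $\mathcal{O}_I$. A randomized algorithm is non-adaptive if its tests do not depend on the answers to other tests. That is, using its random seed only (and $n$), it chooses a (random) collection of tests $Q_1,\dots,Q_s$, receives all the answers $\mathcal{O}_I(Q_1),\dots,\mathcal{O}_I(Q_s)$ simultaneously, and produces an output depending on the seed and these answers. The number of tests it makes is $s=s(n)$. An algorithm $A$, with probability at least $1-\delta$, $\alpha$-estimates the number of defective items if, for every $I\subseteq X$, $A$ runs in time polynomial in $n$, makes tests with the oracle $\mathcal{O}_I$, and, with probability at least $1-\delta$ (over its own randomness), returns an integer $D$ such that $|I|\le D\le\alpha|I|$. Logarithms are to base 2. Write $\log^{[0]}n=n$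 and $\log^{[k]}n=\log(\log^{[k-1]}n)$ for $k\ge1$ (the $k$-fold iterated logarithm $\log\log\cdots\log n$). *)

theory Defs
  imports "HOL-Probability.Probability"
begin

definition test_answer :: "nat set \<Rightarrow> nat set \<Rightarrow> bool" where
  "test_answer I Q \<longleftrightarrow> Q \<inter> I \<noteq> {}"

text \<open>A test strategy for a fixed number of items. Non-adaptivity is built into the types:
  the tests are a function of the seed alone, and only the final estimate sees the answers,
  all of them at once.\<close>

record 'r randomized_strategy =
  seed_space :: "'r measure"
  tests :: "'r \<Rightarrow> nat set list"
  decode :: "'r \<Rightarrow> bool list \<Rightarrow> int"

definition nonadaptive_algorithm :: "nat \<Rightarrow> nat \<Rightarrow> 'r randomized_strategy \<Rightarrow> bool" where
  "nonadaptive_algorithm n s A \<longleftrightarrow>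
     prob_space (seed_space A) \<and>
     tests A \<in> measurable (seed_space A) (count_space UNIV) \<and>
     (\<forall>b. (\<lambda>r. decode A r b) \<in> measurable (seed_space A) (count_space UNIV)) \<and>
     (\<forall>r\<in>space (seed_space A). length (tests A r) = s \<and> (\<forall>Q\<in>set (tests A r). Q \<subseteq> {1..n}))"

definition run :: "'r randomized_strategy \<Rightarrow> nat set \<Rightarrow> 'r \<Rightarrow> int" where
  "run A I r = decode A r (map (test_answer I) (tests A r))"

text \<open>Only correctness is required here, not polynomial running time, so lower bounds for
  algorithms in this sense cover the time-bounded ones in particular.\<close>

definition estimates_defectives :: "nat \<Rightarrow> real \<Rightarrow> real \<Rightarrow> 'r randomized_strategy \<Rightarrow> bool" where
  "estimates_defectives n \<delta> \<alpha> A \<longleftrightarrow>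
     (\<forall>I. I \<subseteq> {1..n} \<longrightarrow>
        measure (seed_space A)
          {r \<in> space (seed_space A).
             real (card I) \<le> real_of_int (run A I r) \<and>
             real_of_int (run A I r) \<le> \<alpha> * real (card I)} \<ge> 1 - \<delta>)"

definition iterated_log :: "nat \<Rightarrow> real \<Rightarrow> real" where
  "iterated_log k x = (log 2 ^^ k) x"

text \<open>Seeds are bit sequences with an arbitrary law. Leaving the seed type polymorphic would let
  constants in an asymptotic bound depend on that type. Fixing it loses no generality: with s tests
  on n items, a seed matters only through its tests and the integers it assigns to the answer
  vectors of length s, which is countably much information.\<close>

type_synonym bit_seed = "nat \<Rightarrow> bool"

end

theory Submission imports Defs "HOL-Real_Asymp.Real_Asymp" begin

text \<open>Let \<open>b > \<alpha>\<close> be an integer and let \<open>I\<close> be a uniformly random set of \<open>b ^ i\<close> or \<open>b ^ Suc i\<close>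
  items.  A test \<open>Q\<close> then answers \<open>card Q * b ^ i > n\<close>, except with a probability that decays
  geometrically in the distance of \<open>b ^ i\<close> from \<open>n / card Q\<close>; summed over all \<open>i\<close>, these
  probabilities are bounded by a constant.  If all tests answer as predicted, the estimate is the
  same for both sizes, hence wrong for one of them.  So for every fixed seed, over the \<open>L\<close> pairs of
  consecutive sizes, the success probabilities add up to at most \<open>L + O(s)\<close>, whereas on average
  over the seeds they add up to at least \<open>4 * L / 3\<close>.  This forces \<open>s = \<Omega>(L) = \<Omega>(log n)\<close>, which is
  even stronger than the claim.\<close>

section \<open>Ratios of binomial coefficients\<close>

text \<open>The ratio of the two binomial coefficients is the product of
  \<open>(m - j) / (n - j)\<close> over \<open>j < d\<close>, and \<open>m \<le> n\<close> makes
  each factor at most \<open>m / n\<close>.\<close>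

lemma binomial_le_power_ratio:
  assumes "m \<le> n" "d \<le> n"
  shows "real (m choose d) * real n ^ d \<le> real m ^ d * real (n choose d)"
  using assms(2)
proof (induction d)
  case 0
  then show ?case by simp
next
  case (Suc d)
  show ?case
  proof (cases "m \<le> d")
    case True
    then have "m choose Suc d = 0" by (simp add: binomial_eq_0)
    then show ?thesis by (simp only: of_nat_0 mult_zero_left) simp
  next
    case False
    have step: "real (Suc d) * real (j choose Suc d) = (real j - real d) * real (j choose d)"
      if "d \<le> j" for j
    proof -
      have "Suc d * (j choose Suc d) = (j - d) * (j choose d)"
        by (simp only: binomial_absorption binomial_absorb_comp)
      then show ?thesis using that by (metis of_nat_diff of_nat_mult)
    qed
    have ratio: "(real m - real d) * real n \<le> real m * (real n - real d)"
      using assms(1) by (simp add: algebra_simps mult_left_mono)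
    have "real (Suc d) * (real (m choose Suc d) * real n ^ Suc d)
        = (real (Suc d) * real (m choose Suc d)) * (real n * real n ^ d)"
      by simp
    also have "\<dots> = ((real m - real d) * real n) * (real (m choose d) * real n ^ d)"
      using False by (subst step) auto
    also have "\<dots> \<le> (real m * (real n - real d)) * (real m ^ d * real (n choose d))"
      by (rule mult_mono[OF ratio Suc.IH]) (use Suc.prems in auto)
    also have "\<dots> = real m ^ Suc d * ((real n - real d) * real (n choose d))"
      by simp
    also have "\<dots> = real (Suc d) * (real m ^ Suc d * real (n choose Suc d))"
      using Suc.prems by (subst step[symmetric]) auto
    finally show ?thesis by (simp only: mult_le_cancel_left_pos of_nat_0_less_iff zero_less_Suc)
  qed
qed

text \<open>The ratio of the binomial coefficients is the probability that a random
  \<open>d\<close>-set misses a fixed \<open>q\<close>-set, and \<open>x\<close> is the expected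
  size of their intersection. The lower bound is a union bound over the \<open>q\<close> items; the
  upper bound is \<open>(1 - q / n) ^ d \<le> exp (- x)\<close>.\<close>

lemma binomial_diff_bounds:
  assumes "q \<le> n" "0 < d" "d \<le> n"
  defines "x \<equiv> real q * real d / real n"
  shows binomial_diff_ge: "(1 - x) * real (n choose d) \<le> real ((n - q) choose d)"
    and binomial_diff_le: "real ((n - q) choose d) \<le> exp (- x) * real (n choose d)"
proof -
  have n: "0 < n" using assms by simp
  \<comment> \<open>Each of the \<open>q\<close> forbidden items lies in
    \<open>(n - 1) choose (d - 1)\<close> of the \<open>d\<close>-sets; forbidding them one at a
    time is Pascal's rule.\<close>
  have "real (n choose d) - real q * real ((n - 1) choose (d - 1)) \<le> real ((n - q) choose d)"
    using assms(1)
  proof (induction q)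
    case 0
    then show ?case by simp
  next
    case (Suc q)
    have "(n - q) choose d = ((n - Suc q) choose (d - 1)) + ((n - Suc q) choose d)"
      using Suc.prems assms(2) by (subst choose_reduce_nat) auto
    moreover have "(n - Suc q) choose (d - 1) \<le> (n - 1) choose (d - 1)"
      by (rule binomial_right_mono) simp
    ultimately show ?case using Suc by (simp add: algebra_simps)
  qed
  moreover have "real n * real ((n - 1) choose (d - 1)) = real d * real (n choose d)"
    using times_binomial_minus1_eq[OF assms(2), of n] by (metis of_nat_mult)
  then have "real q * real ((n - 1) choose (d - 1)) = x * real (n choose d)"
    using n by (simp add: x_def field_simps)
  ultimately show "(1 - x) * real (n choose d) \<le> real ((n - q) choose d)"
    by (simp add: algebra_simps)
  have "real ((n - q) choose d) * real n ^ d \<le> real (n - q) ^ d * real (n choose d)"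
    by (rule binomial_le_power_ratio) (use assms in auto)
  then have "real ((n - q) choose d) \<le> (real (n - q) / real n) ^ d * real (n choose d)"
    using n by (simp add: field_simps)
  also have "\<dots> \<le> exp (- x) * real (n choose d)"
  proof (intro mult_right_mono)
    have "real (n - q) / real n = 1 + - (real q / real n)"
      using n assms(1) by (simp add: of_nat_diff field_simps)
    also have "\<dots> \<le> exp (- (real q / real n))" by (rule exp_ge_add_one_self)
    finally have "(real (n - q) / real n) ^ d \<le> exp (- (real q / real n)) ^ d"
      by (intro power_mono) auto
    also have "\<dots> = exp (- x)" by (simp add: x_def exp_of_nat_mult[symmetric])
    finally show "(real (n - q) / real n) ^ d \<le> exp (- x)" .
  qed auto
  finally show "real ((n - q) choose d) \<le> exp (- x) * real (n choose d)" .
qed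

section \<open>Uniformly random sets of a given size\<close>

definition subsets_of_size :: "nat \<Rightarrow> nat \<Rightarrow> nat set set" where
  "subsets_of_size n d = {I. I \<subseteq> {1..n} \<and> card I = d}"

text \<open>Counting in place of a measure keeps this a finite average, so that it can be exchanged
  with the integral over seeds by linearity. For \<open>d > n\<close> the value is 0.\<close>

definition size_prob :: "nat \<Rightarrow> nat \<Rightarrow> (nat set \<Rightarrow> bool) \<Rightarrow> real" where
  "size_prob n d P = real (card {I \<in> subsets_of_size n d. P I}) / real (n choose d)"

lemma finite_subsets_of_size [simp]: "finite (subsets_of_size n d)"
  by (simp add: subsets_of_size_def)

lemma card_subsets_of_size: "card (subsets_of_size n d) = n choose d"
  by (simp add: subsets_of_size_def n_subsets)

lemma size_prob_mono:
  "(\<And>I. I \<in> subsets_of_size n d \<Longrightarrow> P I \<Longrightarrow> P' I) \<Longrightarrow> size_prob n d P \<le> size_prob n d P'"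
  unfolding size_prob_def by (intro divide_right_mono of_nat_mono card_mono) auto

lemma size_prob_le_1: "size_prob n d P \<le> 1"
proof -
  have "card {I \<in> subsets_of_size n d. P I} \<le> n choose d"
    unfolding card_subsets_of_size[symmetric] by (intro card_mono) auto
  then show ?thesis by (simp add: size_prob_def divide_le_eq)
qed

lemma size_prob_disj_le:
  "size_prob n d (\<lambda>I. P I \<or> P' I) \<le> size_prob n d P + size_prob n d P'"
proof -
  have "{I \<in> subsets_of_size n d. P I \<or> P' I}
      = {I \<in> subsets_of_size n d. P I} \<union> {I \<in> subsets_of_size n d. P' I}" by auto
  then show ?thesis
    unfolding size_prob_def add_divide_distrib[symmetric]
    by (intro divide_right_mono) (simp_all add: card_Un_le flip: of_nat_add)
qed

lemma size_prob_Bex_le: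
  "size_prob n d (\<lambda>I. \<exists>Q\<in>set Qs. P Q I) \<le> (\<Sum>Q\<leftarrow>Qs. size_prob n d (P Q))"
proof (induction Qs)
  case Nil
  then show ?case by (simp add: size_prob_def)
next
  case (Cons Q Qs)
  have "size_prob n d (\<lambda>I. \<exists>Q'\<in>set (Q # Qs). P Q' I)
      \<le> size_prob n d (P Q) + size_prob n d (\<lambda>I. \<exists>Q'\<in>set Qs. P Q' I)"
    using size_prob_disj_le[of n d "P Q"] by simp
  then show ?case using Cons by simp
qed

text \<open>A negative answer means that \<open>I\<close> is a \<open>d\<close>-subset of the
  complement of \<open>Q\<close>, so the binomial bounds apply with
  \<open>q = card Q\<close>.\<close>

lemma size_prob_test_answer:
  assumes Q: "Q \<subseteq> {1..n}" and d: "0 < d" "d \<le> n"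
  defines "x \<equiv> real (card Q) * real d / real n"
  shows size_prob_positive_le: "size_prob n d (\<lambda>I. test_answer I Q) \<le> x"
    and size_prob_negative_le: "x > 0 \<Longrightarrow> size_prob n d (\<lambda>I. \<not> test_answer I Q) \<le> 1 / x"
proof -
  have q: "card Q \<le> n" using card_mono[OF _ Q] by simp
  have pos: "0 < n choose d" using d by simp
  have "{I \<in> subsets_of_size n d. \<not> test_answer I Q} = {I. I \<subseteq> {1..n} - Q \<and> card I = d}"
    by (auto simp: subsets_of_size_def test_answer_def)
  then have neg: "card {I \<in> subsets_of_size n d. \<not> test_answer I Q} = (n - card Q) choose d"
    using Q by (simp add: n_subsets card_Diff_subset finite_subset)
  have "{I \<in> subsets_of_size n d. test_answer I Q}
      = subsets_of_size n d - {I \<in> subsets_of_size n d. \<not> test_answer I Q}" by auto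
  moreover have "card {I \<in> subsets_of_size n d. \<not> test_answer I Q} \<le> card (subsets_of_size n d)"
    by (intro card_mono) auto
  ultimately have "real (card {I \<in> subsets_of_size n d. test_answer I Q})
      = real (n choose d) - real ((n - card Q) choose d)"
    using neg by (simp add: card_Diff_subset card_subsets_of_size of_nat_diff)
  also have "\<dots> \<le> x * real (n choose d)"
    using binomial_diff_ge[OF q d] by (simp add: x_def algebra_simps)
  finally show "size_prob n d (\<lambda>I. test_answer I Q) \<le> x"
    using pos by (simp add: size_prob_def divide_le_eq)
  assume x: "x > 0"
  have "size_prob n d (\<lambda>I. \<not> test_answer I Q) \<le> exp (- x)"
    using binomial_diff_le[OF q d] pos by (simp add: size_prob_def neg x_def divide_le_eq)
  \<comment> \<open>This weaker bound suffices: along geometrically growing sizes it still gives a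
    geometric series.\<close>
  also have "\<dots> \<le> 1 / x"
  proof -
    have "x \<le> exp x" using exp_ge_add_one_self[of x] by linarith
    then show ?thesis using x by (simp add: exp_minus field_simps)
  qed
  finally show "size_prob n d (\<lambda>I. \<not> test_answer I Q) \<le> 1 / x" .
qed

section \<open>Geometric sums below and above the threshold 1\<close>

text \<open>Since terms at least double, the sum never exceeds the next term
  \<open>y * b ^ L\<close>. Carrying this in the bound makes the induction work; the last term
  counted is at most 1, whence the 2.\<close>

lemma sum_geometric_capped_le:
  fixes y b :: real
  assumes "0 \<le> y" "2 \<le> b"
  shows "(\<Sum>i<L. if y * b ^ i \<le> 1 then y * b ^ i else 0) \<le> min 2 (y * b ^ L)"
proof (induction L)
  case 0
  then show ?case using assms by simp
next
  case (Suc L)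
  have "2 * (y * b ^ L) \<le> b * (y * b ^ L)" using assms by (intro mult_right_mono) auto
  then have *: "2 * (y * b ^ L) \<le> y * b ^ Suc L" by (simp add: algebra_simps)
  have "0 \<le> y * b ^ L" using assms by simp
  with * Suc show ?case by (auto simp del: power_Suc)
qed

text \<open>With \<open>z = y * b ^ L\<close>, the inequality
  \<open>1 / z \<le> 2 / z - 2 / (b * z)\<close> makes the sum telescope; the maximum with 0 covers
  the stretch before the threshold.\<close>

lemma sum_geometric_inverse_le:
  fixes y b :: real
  assumes "0 < y" "2 \<le> b"
  shows "(\<Sum>i<L. if 1 < y * b ^ i then 1 / (y * b ^ i) else 0) \<le> max 0 (2 - 2 / (y * b ^ L))"
proof (induction L)
  case 0
  then show ?case by simp
next
  case (Suc L)
  define z where "z = y * b ^ L"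
  have z: "0 < z" using assms by (simp add: z_def)
  have "2 / (b * z) \<le> 2 / (2 * z)" using assms z by (intro divide_left_mono) auto
  then have *: "2 / (b * z) \<le> 1 / z" by simp
  show ?case
  proof (cases "1 < z")
    case True
    then have "2 / z < 2" using z by (simp add: field_simps)
    then show ?thesis using Suc * True z by (simp add: z_def[symmetric] mult.left_commute)
  next
    case False
    then have "2 \<le> 2 / z" using z by (simp add: field_simps)
    then show ?thesis using Suc False by (simp add: z_def[symmetric])
  qed
qed

section \<open>Mispredicted answers of a single test\<close>

text \<open>Compares the expected intersection size \<open>card Q * e / n\<close> with 1. Here
  \<open>e\<close> will be the smaller size of a pair, so that both sizes share one
  prediction.\<close>

definition predicted_answer :: "nat \<Rightarrow> nat \<Rightarrow> nat set \<Rightarrow> bool" where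
  "predicted_answer n e Q \<longleftrightarrow> n < card Q * e"

text \<open>Leaving \<open>d\<close> free lets one bound serve both sizes of every pair. Sizes below
  the threshold contribute the sum of \<open>?A\<close>, those above it the sum of
  \<open>?B\<close>, each at most 2.\<close>

lemma sum_mispredict_le:
  assumes Q: "Q \<subseteq> {1..n}" and b: "2 \<le> b" and L: "b ^ L \<le> n"
    and d: "\<And>i. i < L \<Longrightarrow> b ^ i \<le> d i \<and> d i \<le> b ^ Suc i"
  shows "(\<Sum>i<L. size_prob n (d i) (\<lambda>I. test_answer I Q \<noteq> predicted_answer n (b ^ i) Q))
           \<le> 2 + 2 * real b"
proof -
  define y where "y = real (card Q) / real n"
  have "0 < b ^ L" using b by simp
  then have n: "0 < n" using L by linarith
  have y: "0 \<le> y" by (simp add: y_def)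
  let ?A = "\<lambda>i. if y * real b ^ i \<le> 1 then y * real b ^ i else 0"
  let ?B = "\<lambda>i. if 1 < y * real b ^ i then 1 / (y * real b ^ i) else 0"
  \<comment> \<open>The factor \<open>b\<close> pays for \<open>d i\<close> being as large as
    \<open>b ^ Suc i\<close> although the prediction is made for \<open>b ^ i\<close>.\<close>
  have bound: "size_prob n (d i) (\<lambda>I. test_answer I Q \<noteq> predicted_answer n (b ^ i) Q)
      \<le> real b * ?A i + ?B i" if i: "i < L" for i
  proof -
    have "0 < b ^ i" using b by simp
    then have d0: "0 < d i" using d[OF i] by linarith
    have "b ^ Suc i \<le> b ^ L" using i b by (intro power_increasing) auto
    then have dn: "d i \<le> n" using d[OF i] L by linarith
    have eq: "real (card Q) * real (d i) / real n = y * real (d i)" by (simp add: y_def)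
    have pred: "predicted_answer n (b ^ i) Q \<longleftrightarrow> 1 < y * real b ^ i"
    proof -
      have "predicted_answer n (b ^ i) Q \<longleftrightarrow> real n < real (card Q) * real b ^ i"
        unfolding predicted_answer_def
        by (metis of_nat_less_iff of_nat_mult of_nat_power)
      then show ?thesis using n by (simp add: y_def field_simps)
    qed
    show ?thesis
    proof (cases "1 < y * real b ^ i")
      case True
      then have y0: "0 < y" using y by (cases "y = 0") auto
      have le: "real b ^ i \<le> real (d i)" using d[OF i] by (metis of_nat_le_iff of_nat_power)
      have "size_prob n (d i) (\<lambda>I. test_answer I Q \<noteq> predicted_answer n (b ^ i) Q)
          = size_prob n (d i) (\<lambda>I. \<not> test_answer I Q)"
        using True pred by simp
      also have "\<dots> \<le> 1 / (y * real (d i))"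
        using size_prob_negative_le[OF Q d0 dn] y0 d0 by (simp add: eq)
      also have "\<dots> \<le> 1 / (y * real b ^ i)"
        using y0 b le d0 by (intro divide_left_mono mult_left_mono) auto
      finally show ?thesis using True by simp
    next
      case False
      have "real (d i) \<le> real b * real b ^ i"
        using d[OF i] by (metis of_nat_le_iff of_nat_power power_Suc)
      then have "y * real (d i) \<le> y * (real b * real b ^ i)" using y by (rule mult_left_mono)
      moreover have "size_prob n (d i) (\<lambda>I. test_answer I Q \<noteq> predicted_answer n (b ^ i) Q)
          \<le> y * real (d i)"
        using False pred size_prob_positive_le[OF Q d0 dn] by (simp add: eq)
      ultimately show ?thesis using False by (simp add: algebra_simps)
    qed
  qed
  have "(\<Sum>i<L. ?B i) \<le> 2"
  proof (cases "y = 0")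
    case False
    have "max 0 (2 - 2 / (y * real b ^ L)) \<le> 2" using y by simp
    moreover have "(\<Sum>i<L. ?B i) \<le> max 0 (2 - 2 / (y * real b ^ L))"
      using False y b by (intro sum_geometric_inverse_le) auto
    ultimately show ?thesis by (rule order_trans[rotated])
  qed simp
  moreover have "(\<Sum>i<L. ?A i) \<le> 2"
    using sum_geometric_capped_le[of y "real b" L] y b by simp
  then have "real b * (\<Sum>i<L. ?A i) \<le> real b * 2" by (intro mult_left_mono) auto
  moreover have "(\<Sum>i<L. size_prob n (d i) (\<lambda>I. test_answer I Q \<noteq> predicted_answer n (b ^ i) Q))
      \<le> (\<Sum>i<L. real b * ?A i + ?B i)"
    using bound by (intro sum_mono) auto
  ultimately show ?thesis by (simp add: sum.distrib sum_distrib_left)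
qed

section \<open>Success probabilities for a fixed seed\<close>

definition good_estimate :: "real \<Rightarrow> 'r randomized_strategy \<Rightarrow> 'r \<Rightarrow> nat set \<Rightarrow> bool" where
  "good_estimate \<alpha> A r I \<longleftrightarrow>
     real (card I) \<le> real_of_int (run A I r) \<and> real_of_int (run A I r) \<le> \<alpha> * real (card I)"

text \<open>Under the predicted answers the output is one number \<open>D\<close>, correct for at
  most one size of the pair; this gives the \<open>L\<close>. Any other success needs a mispredicted
  test, and each test costs at most \<open>2 + 2 * b\<close> for each of the two choices of
  size.\<close>

lemma size_prob_good_estimate_le:
  assumes tests: "\<forall>Q\<in>set (tests A r). Q \<subseteq> {1..n}" "length (tests A r) = s"
    and b: "2 \<le> b" "\<alpha> < real b" and L: "b ^ L \<le> n"
  shows "(\<Sum>i<L. size_prob n (b ^ i) (good_estimate \<alpha> A r)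
                + size_prob n (b ^ Suc i) (good_estimate \<alpha> A r))
           \<le> real L + (4 + 4 * real b) * real s"
proof -
  define mis where "mis d i Q = size_prob n d (\<lambda>I. test_answer I Q \<noteq> predicted_answer n (b ^ i) Q)"
    for d i Q
  define Qs where "Qs = tests A r"
  have pair: "size_prob n (b ^ i) (good_estimate \<alpha> A r) + size_prob n (b ^ Suc i) (good_estimate \<alpha> A r)
      \<le> 1 + ((\<Sum>Q\<leftarrow>Qs. mis (b ^ i) i Q) + (\<Sum>Q\<leftarrow>Qs. mis (b ^ Suc i) i Q))" for i
  proof -
    define D where "D = real_of_int (decode A r (map (predicted_answer n (b ^ i)) Qs))"
    define ok where "ok d \<longleftrightarrow> real d \<le> D \<and> D \<le> \<alpha> * real d" for d
    have bound: "size_prob n d (good_estimate \<alpha> A r) \<le> of_bool (ok d) + (\<Sum>Q\<leftarrow>Qs. mis d i Q)" for d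
    proof -
      have *: "size_prob n d (good_estimate \<alpha> A r)
          \<le> size_prob n d (\<lambda>I. ok d \<or> (\<exists>Q\<in>set Qs. test_answer I Q \<noteq> predicted_answer n (b ^ i) Q))"
      proof (rule size_prob_mono)
        fix I assume "I \<in> subsets_of_size n d" and good: "good_estimate \<alpha> A r I"
        then have card: "card I = d" by (simp add: subsets_of_size_def)
        show "ok d \<or> (\<exists>Q\<in>set Qs. test_answer I Q \<noteq> predicted_answer n (b ^ i) Q)"
        proof (cases "\<exists>Q\<in>set Qs. test_answer I Q \<noteq> predicted_answer n (b ^ i) Q")
          case False
          then have "map (test_answer I) Qs = map (predicted_answer n (b ^ i)) Qs" by simp
          then have "D = real_of_int (run A I r)"
            by (simp only: D_def run_def Qs_def)
          then show ?thesis using good card by (simp add: good_estimate_def ok_def)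
        qed simp
      qed
      also have "\<dots> \<le> size_prob n d (\<lambda>I. ok d)
          + size_prob n d (\<lambda>I. \<exists>Q\<in>set Qs. test_answer I Q \<noteq> predicted_answer n (b ^ i) Q)"
        by (rule size_prob_disj_le)
      also have "size_prob n d (\<lambda>I. ok d) \<le> of_bool (ok d)"
        using size_prob_le_1[of n d "\<lambda>I. True"] by (cases "ok d") (simp_all add: size_prob_def)
      also have "size_prob n d (\<lambda>I. \<exists>Q\<in>set Qs. test_answer I Q \<noteq> predicted_answer n (b ^ i) Q)
          \<le> (\<Sum>Q\<leftarrow>Qs. mis d i Q)"
        unfolding mis_def by (rule size_prob_Bex_le)
      finally show ?thesis by simp
    qed
    \<comment> \<open>The admissible ranges for sizes \<open>b ^ i\<close> and
      \<open>b ^ Suc i\<close> are disjoint.\<close>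
    have "\<alpha> * real b ^ i < real b * real b ^ i" using b by (intro mult_strict_right_mono) auto
    then have "\<not> (ok (b ^ i) \<and> ok (b ^ Suc i))" by (auto simp: ok_def)
    then have "of_bool (ok (b ^ i)) + of_bool (ok (b ^ Suc i)) \<le> (1 :: real)" by (auto simp: of_bool_def)
    then show ?thesis using bound[of "b ^ i"] bound[of "b ^ Suc i"] by linarith
  qed
  have mis_sum: "(\<Sum>i<L. \<Sum>Q\<leftarrow>Qs. mis (d i) i Q) \<le> (2 + 2 * real b) * real s"
    if d: "\<And>i. i < L \<Longrightarrow> b ^ i \<le> d i \<and> d i \<le> b ^ Suc i" for d
  proof -
    have "(\<Sum>i<L. \<Sum>Q\<leftarrow>Qs'. mis (d i) i Q) \<le> (2 + 2 * real b) * real (length Qs')"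
      if "\<forall>Q\<in>set Qs'. Q \<subseteq> {1..n}" for Qs'
      using that
    proof (induction Qs')
      case (Cons Q Qs')
      moreover have "(\<Sum>i<L. mis (d i) i Q) \<le> 2 + 2 * real b"
        unfolding mis_def by (rule sum_mispredict_le) (use Cons.prems b L d in auto)
      ultimately show ?case by (simp add: sum.distrib algebra_simps)
    qed simp
    then show ?thesis using tests by (auto simp: Qs_def)
  qed
  have "(\<Sum>i<L. \<Sum>Q\<leftarrow>Qs. mis (b ^ i) i Q) \<le> (2 + 2 * real b) * real s"
    using b by (intro mis_sum) auto
  moreover have "(\<Sum>i<L. \<Sum>Q\<leftarrow>Qs. mis (b ^ Suc i) i Q) \<le> (2 + 2 * real b) * real s"
    using b by (intro mis_sum) auto
  ultimately show ?thesis
    using sum_mono[OF pair, of "\<lambda>i. i" "{..<L}"] by (simp add: sum.distrib algebra_simps)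
qed

section \<open>Averaging over the seed\<close>

text \<open>Each fixed \<open>I\<close> succeeds with probability at least 2/3 over the seed, so the
  average over all \<open>I\<close> of size \<open>d\<close> does too; exchanging the finite sum and
  the integral gives the claim.\<close>

lemma expectation_size_prob_ge:
  assumes "prob_space (seed_space A)" and est: "estimates_defectives n (1/3) \<alpha> A" and "d \<le> n"
  shows "integrable (seed_space A) (\<lambda>r. size_prob n d (good_estimate \<alpha> A r))"
    and "2 / 3 \<le> (\<integral>r. size_prob n d (good_estimate \<alpha> A r) \<partial>seed_space A)"
proof -
  interpret prob_space "seed_space A" by fact
  let ?M = "seed_space A" and ?S = "subsets_of_size n d"
  define G where "G I = {r \<in> space ?M. good_estimate \<alpha> A r I}" for I
  have G: "2 / 3 \<le> measure ?M (G I)" if "I \<in> ?S" for I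
    using est that by (auto simp: estimates_defectives_def subsets_of_size_def G_def good_estimate_def)
  \<comment> \<open>\<open>measure\<close> vanishes outside the \<open>\<sigma>\<close>-algebra.\<close>
  have sets: "G I \<in> sets ?M" if "I \<in> ?S" for I
    using G[OF that] measure_notin_sets[of "G I" ?M] by fastforce
  have eq: "size_prob n d (good_estimate \<alpha> A r) = (\<Sum>I\<in>?S. indicator (G I) r) / real (n choose d)"
    if "r \<in> space ?M" for r
  proof -
    have "(\<Sum>I\<in>?S. indicator (G I) r :: real) = (\<Sum>I\<in>?S. of_bool (good_estimate \<alpha> A r I))"
      using that by (intro sum.cong) (auto simp: G_def indicator_def)
    also have "\<dots> = real (card {I \<in> ?S. good_estimate \<alpha> A r I})"
      by (simp add: Int_def)
    finally show ?thesis by (simp add: size_prob_def)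
  qed
  have int: "integrable ?M (indicator (G I) :: _ \<Rightarrow> real)" if "I \<in> ?S" for I
    using sets[OF that] by (intro integrable_real_indicator) (auto simp: emeasure_eq_measure)
  have int_sum: "integrable ?M (\<lambda>r. (\<Sum>I\<in>?S. indicator (G I) r) / real (n choose d))"
    using int by (intro integrable_divide Bochner_Integration.integrable_sum) auto
  then show "integrable ?M (\<lambda>r. size_prob n d (good_estimate \<alpha> A r))"
    by (subst Bochner_Integration.integrable_cong[OF refl eq]) auto
  have "(\<integral>r. size_prob n d (good_estimate \<alpha> A r) \<partial>?M)
      = (\<integral>r. (\<Sum>I\<in>?S. indicator (G I) r) / real (n choose d) \<partial>?M)"
    by (intro Bochner_Integration.integral_cong refl eq)
  also have "\<dots> = (\<Sum>I\<in>?S. measure ?M (G I)) / real (n choose d)"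
    using int sets by (simp add: Bochner_Integration.integral_sum)
  also have "\<dots> \<ge> (\<Sum>I\<in>?S. 2 / 3) / real (n choose d)"
    using G by (intro divide_right_mono sum_mono) auto
  moreover have "(\<Sum>I\<in>?S. 2 / 3) / real (n choose d) = 2 / 3"
    using \<open>d \<le> n\<close> by (simp add: card_subsets_of_size)
  ultimately show "2 / 3 \<le> (\<integral>r. size_prob n d (good_estimate \<alpha> A r) \<partial>?M)" by linarith
qed

text \<open>Combining the average with the bound for each seed gives
  \<open>4 * L / 3 \<le> L + 4 * (1 + b) * s\<close>, hence the constant 12.\<close>

lemma number_of_tests_ge:
  assumes alg: "nonadaptive_algorithm n s A" and est: "estimates_defectives n (1/3) \<alpha> A"
    and b: "2 \<le> b" "\<alpha> < real b" and L: "b ^ L \<le> n"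
  shows "real L \<le> 12 * (1 + real b) * real s"
proof -
  interpret prob_space "seed_space A" using alg by (simp add: nonadaptive_algorithm_def)
  let ?M = "seed_space A"
  let ?f = "\<lambda>i r. size_prob n (b ^ i) (good_estimate \<alpha> A r)"
  have le: "b ^ i \<le> n" if "i \<le> L" for i
    using power_increasing[OF that, of b] b L by linarith
  note exp = expectation_size_prob_ge[OF prob_space_axioms est le]
  have int: "integrable ?M (\<lambda>r. \<Sum>i<L. ?f i r + ?f (Suc i) r)"
    by (intro Bochner_Integration.integrable_sum Bochner_Integration.integrable_add exp(1)) auto
  have "real L * (4 / 3) = (\<Sum>i<L. 2 / 3 + 2 / 3)" by simp
  also have "\<dots> \<le> (\<Sum>i<L. (\<integral>r. ?f i r \<partial>?M) + (\<integral>r. ?f (Suc i) r \<partial>?M))"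
    by (intro sum_mono add_mono exp(2)) auto
  also have "\<dots> = (\<integral>r. (\<Sum>i<L. ?f i r + ?f (Suc i) r) \<partial>?M)"
    using exp(1) by (simp add: Bochner_Integration.integral_sum Bochner_Integration.integral_add
      del: power_Suc)
  also have "\<dots> \<le> real L + (4 + 4 * real b) * real s"
    using int alg b L
    by (intro integral_le_const AE_I2 size_prob_good_estimate_le)
       (auto simp: nonadaptive_algorithm_def)
  finally show ?thesis by (simp add: algebra_simps)
qed

section \<open>From the number of scales to the logarithmic bound\<close>

lemma filterlim_iterated_log: "filterlim (iterated_log k) at_top at_top"
proof (induction k)
  case 0
  then show ?case by (simp add: iterated_log_def filterlim_ident)
next
  case (Suc k)
  have "filterlim (log 2) at_top (at_top :: real filter)" by real_asymp
  from filterlim_compose[OF this Suc] show ?case by (simp add: iterated_log_def)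
qed

theorem mainTheorem2:
  fixes k :: nat and \<alpha> :: real
  assumes "k \<ge> 1"
  shows "\<exists>c::real. c > 0 \<and> (\<exists>n0::nat. \<forall>n\<ge>n0. \<forall>s::nat. \<forall>A :: bit_seed randomized_strategy.
           nonadaptive_algorithm n s A \<and> estimates_defectives n (1/3) \<alpha> A \<longrightarrow>
           real s \<ge> c * (log 2 (real n) / iterated_log k (real n)))"
proof -
  \<comment> \<open>The added 1 makes \<open>\<alpha> < b\<close> strict even for integral
    \<open>\<alpha>\<close>, and the maximum ensures \<open>b \<ge> 2\<close>.\<close>
  define b where "b = nat \<lceil>max \<alpha> 1\<rceil> + 1"
  have b: "2 \<le> b" "\<alpha> < real b" unfolding b_def by linarith+
  \<comment> \<open>The 2 is the loss from rounding \<open>log b n\<close> down to \<open>L\<close>,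
    and \<open>log 2 b\<close> is the change of base.\<close>
  define C where "C = 12 * (1 + real b) * (2 * log 2 (real b))"
  have logb: "0 < log 2 (real b)" using b by simp
  then have C: "0 < C" by (simp add: C_def)
  have "eventually (\<lambda>n. 1 \<le> iterated_log k (real n)) sequentially"
    using filterlim_compose[OF filterlim_iterated_log filterlim_real_sequentially]
    by (auto simp: filterlim_at_top)
  then obtain n1 where n1: "\<And>n. n \<ge> n1 \<Longrightarrow> 1 \<le> iterated_log k (real n)"
    by (auto simp: eventually_sequentially)
  have "real s \<ge> 1 / C * (log 2 (real n) / iterated_log k (real n))"
    if n: "n \<ge> max n1 b" and A: "nonadaptive_algorithm n s A" "estimates_defectives n (1/3) \<alpha> A"
    for n s and A :: "bit_seed randomized_strategy"
  proof -
    have n0: "0 < n" using n b by simp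
    define L where "L = nat \<lfloor>log (real b) (real n)\<rfloor>"
    have "log (real b) (real b) \<le> log (real b) (real n)"
      using n b by (subst log_le_cancel_iff) auto
    then have log1: "1 \<le> log (real b) (real n)" using b by simp
    then have "1 \<le> \<lfloor>log (real b) (real n)\<rfloor>" by (simp add: le_floor_iff)
    \<comment> \<open>As \<open>L \<ge> 1\<close>, the logarithm lies below
      \<open>L + 1 \<le> 2 * L\<close>.\<close>
    then have "real L = of_int \<lfloor>log (real b) (real n)\<rfloor>" "1 \<le> real L"
      unfolding L_def by linarith+
    then have L: "real L \<le> log (real b) (real n)" "log (real b) (real n) \<le> 2 * real L"
      by linarith+
    have "real b powr real L \<le> real n"
      using L(1) b n0 by (simp add: le_log_iff)
    then have "b ^ L \<le> n"
      using b by (simp add: powr_realpow flip: of_nat_power)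
    from number_of_tests_ge[OF A b this]
    have Ls: "real L \<le> 12 * (1 + real b) * real s" .
    have "log 2 (real n) = log (real b) (real n) * log 2 (real b)"
      using b n0 by (simp add: log_def)
    also have "\<dots> \<le> (2 * (12 * (1 + real b) * real s)) * log 2 (real b)"
      using L(2) Ls logb by (intro mult_right_mono) auto
    also have "\<dots> = C * real s" by (simp add: C_def)
    finally have *: "log 2 (real n) \<le> C * real s" .
    \<comment> \<open>The bound \<open>log 2 n \<le> C * s\<close> is weakened to the claimed form,
      the iterated logarithm being at least 1 from \<open>n1\<close> on.\<close>
    have "log 2 (real n) / iterated_log k (real n) \<le> log 2 (real n) / 1"
      using n1[of n] n n0 by (intro divide_left_mono) auto
    also have "\<dots> \<le> C * real s" using * by simp
    finally have "(log 2 (real n) / iterated_log k (real n)) / C \<le> real s"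
      using C by (subst pos_divide_le_eq) (auto simp: mult.commute)
    then show ?thesis by (simp add: mult.commute)
  qed
  then show ?thesis
    using C by (intro exI[of _ "1 / C"] exI[of _ "max n1 b"] conjI allI impI) (simp, blast)
qed

end
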